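(* Let $q\ge 3$ be a prime power, let $\mathcal{Q}'$ be a quadric in $PG(3,q)=\mathbb{P}^3(\mathbb{F}_q)$ and let $X\subset\mathbb{P}^3(\mathbb{F}_q)$ be a quadric cone. Then the number of points of $\mathbb{P}^3(\mathbb{F}_q)$ lying on both $X$ and $\mathcal{Q}'$ satisfies $$\#(X\cap \mathcal{Q}')(\mathbb{F}_q)=4q+1,\quad\text{or}\quad \#(X\cap \mathcal{Q}')(\mathbb{F}_q)=3q+1,\quad\text{or}\quad \#(X\cap \mathcal{Q}')(\mathbb{F}_q)\le 3q.$$
   Context: $\mathbb{F}_q$ is the field with $q$ elements. A quadric in $PG(3,q)=\mathbb{P}^3(\mathbb{F}_q)$, the projective space of dimension 3 over $\mathbb{F}_q$, is the set of zeros $Z(f)$ of a homogeneous polynomial (form) $f$ of degree 2 in $x_0,\dots,x_3$ over $\mathbb{F}_q$. Its rank is the smallest number of indeterminates appearing in $f$ under any change of coordinate system. A quadric cone is a quadric of rank 3; it has $q^2+q+1$ points and consists of $q+1$ lines (its generators) through a common point (its vertex).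
   Formalization: The quadric Q' is assumed different from the cone X as a set of points: for Q' = X the intersection has q^2+q+1 points, which exceeds 4q+1 for every q ≥ 4, so the claim fails there (for q = 3 the excluded case gives 13 = 4q+1). *)

theory Defs
  imports "HOL-Analysis.Analysis" "HOL-Library.Poly_Mapping"
begin

text \<open>
  The ground field is a type \<open>'a :: {field, finite}\<close> with \<open>q = CARD('a)\<close> elements.
  The coordinates \<open>x\<^sub>0, \<dots>, x\<^sub>3\<close> are indexed by the four-element type \<^typ>\<open>4\<close>,
  whose elements are \<open>0, 1, 2, 3\<close> (and \<open>4 = 0\<close>).
\<close>

type_synonym monom4 = "4 \<Rightarrow>\<^sub>0 nat"
type_synonym 'a poly4 = "monom4 \<Rightarrow>\<^sub>0 'a"

definition const4 :: "'a::zero \<Rightarrow> 'a poly4" where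
  "const4 c = Poly_Mapping.single 0 c"

definition var4 :: "4 \<Rightarrow> 'a::zero_neq_one poly4" where
  "var4 i = Poly_Mapping.single (Poly_Mapping.single i 1) 1"

definition monom_degree :: "monom4 \<Rightarrow> nat" where
  "monom_degree m = (\<Sum>i\<in>UNIV. Poly_Mapping.lookup m i)"

definition quadratic_form :: "'a::zero poly4 \<Rightarrow> bool" where
  "quadratic_form f \<longleftrightarrow> f \<noteq> 0 \<and> (\<forall>m\<in>Poly_Mapping.keys f. monom_degree m = 2)"

definition eval4 :: "'a::comm_semiring_1 poly4 \<Rightarrow> 'a ^ 4 \<Rightarrow> 'a" where
  "eval4 f v = (\<Sum>m\<in>Poly_Mapping.keys f.
     Poly_Mapping.lookup f m * (\<Prod>i\<in>UNIV. (v $ i) ^ Poly_Mapping.lookup m i))"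

definition indeterminates :: "'a::zero poly4 \<Rightarrow> 4 set" where
  "indeterminates f = (\<Union>m\<in>Poly_Mapping.keys f. Poly_Mapping.keys m)"

text \<open>The polynomial obtained from \<open>f\<close> by replacing each \<open>x\<^sub>i\<close> by \<open>\<Sum>j. A $ i $ j * x\<^sub>j\<close>.\<close>

definition lin_subst :: "'a::comm_semiring_1 ^ 4 ^ 4 \<Rightarrow> 'a poly4 \<Rightarrow> 'a poly4" where
  "lin_subst A f = (\<Sum>m\<in>Poly_Mapping.keys f. const4 (Poly_Mapping.lookup f m) *
     (\<Prod>i\<in>UNIV. (\<Sum>j\<in>UNIV. const4 (A $ i $ j) * var4 j) ^ Poly_Mapping.lookup m i))"

definition form_rank :: "'a::comm_semiring_1 poly4 \<Rightarrow> nat" where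
  "form_rank f = (LEAST r. \<exists>A::'a^4^4. invertible A \<and> card (indeterminates (lin_subst A f)) = r)"

definition PG3 :: "('a::field ^ 4) set set" where
  "PG3 = {P. vec.subspace P \<and> vec.dim P = 1}"

text \<open>
  A projective point is a line through the origin, and a form vanishes at the point when it
  vanishes on that whole line; by homogeneity one nonzero representative decides this.
\<close>

definition zero_locus :: "'a::field poly4 \<Rightarrow> ('a ^ 4) set set" where
  "zero_locus f = {P \<in> PG3. \<forall>v\<in>P. eval4 f v = 0}"

definition quadric :: "('a::field ^ 4) set set \<Rightarrow> bool" where
  "quadric Q \<longleftrightarrow> (\<exists>f. quadratic_form f \<and> Q = zero_locus f)"

definition quadric_cone :: "('a::field ^ 4) set set \<Rightarrow> bool" where
  "quadric_cone X \<longleftrightarrow> (\<exists>f. quadratic_form f \<and> form_rank f = 3 \<and> X = zero_locus f)"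

end

theory Submission
  imports Defs "HOL-Computational_Algebra.Polynomial"
begin

text \<open>
  Since the cone has rank \<open>3\<close>, its form \<open>F\<close> has a one-dimensional radical, spanned by the vertex
  \<open>u\<close>. A ternary form over a finite field is isotropic, so there are coordinates in which
  \<open>F = e (c\<^sup>2 - a b)\<close>, with \<open>u\<close> as the fourth basis vector; the points of the cone are then \<open>u\<close> and
  \<open>p s + d u\<close>, where \<open>p s\<close> runs over the \<open>q + 1\<close> points of a conic. Let \<open>G\<close> be the form of the other
  quadric and count the zeros of \<open>G (p s + d u) = G (p s) + d B (p s, u) + d\<^sup>2 G u\<close>.

  If \<open>G u \<noteq> 0\<close>, each generator carries at most two common points. If \<open>G u = 0\<close> and \<open>B (_, u) \<noteq> 0\<close>,
  the binary quadratic form \<open>B (p s, u)\<close> has at most two zeros, and every other generator carries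
  exactly one common point besides the vertex, which gives at most \<open>3 q\<close>. Otherwise the
  intersection consists of full generators, one for each zero of the binary quartic \<open>G (p s)\<close>; this
  quartic vanishes identically only when \<open>G\<close> is a multiple of \<open>F\<close>.
\<close>

subsection \<open>Forms as polynomials and as functions\<close>

text \<open>Unlike \<open>quadratic_form\<close>, this admits the zero polynomial, so it is stable
  under sums and under substitution by an arbitrary, possibly singular, matrix.\<close>

definition homogeneous :: "nat \<Rightarrow> 'a::zero poly4 \<Rightarrow> bool" where
  "homogeneous n f \<longleftrightarrow> (\<forall>m\<in>Poly_Mapping.keys f. monom_degree m = n)"

lemma monom_degree_add: "monom_degree (m + n) = monom_degree m + monom_degree n"
  by (simp add: monom_degree_def lookup_add sum.distrib)

lemma monom_degree_zero [simp]: "monom_degree 0 = 0"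
  by (simp add: monom_degree_def)

lemma monom_degree_single [simp]: "monom_degree (Poly_Mapping.single i k) = k"
  by (simp add: monom_degree_def lookup_single when_def)

lemma monom_degree_eq_0_iff: "monom_degree m = 0 \<longleftrightarrow> m = 0"
  by (auto simp: monom_degree_def intro!: poly_mapping_eqI)

lemma homogeneous_zero [simp]: "homogeneous n 0"
  by (simp add: homogeneous_def)

lemma homogeneous_const4: "homogeneous 0 (const4 c)"
  by (simp add: homogeneous_def const4_def)

lemma homogeneous_var4: "homogeneous 1 (var4 i)"
  by (simp add: homogeneous_def var4_def)

lemma homogeneous_add:
  fixes f g :: "'a::comm_semiring_1 poly4"
  assumes "homogeneous n f" "homogeneous n g"
  shows "homogeneous n (f + g)"
  using assms keys_add[of f g] unfolding homogeneous_def by blast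

lemma homogeneous_mult:
  fixes f g :: "'a::comm_semiring_1 poly4"
  assumes "homogeneous n f" "homogeneous k g"
  shows "homogeneous (n + k) (f * g)"
  using assms keys_mult[of f g] unfolding homogeneous_def by (fastforce simp: monom_degree_add)

lemma homogeneous_sum:
  fixes f :: "'b \<Rightarrow> 'a::comm_semiring_1 poly4"
  assumes "\<And>i. i \<in> S \<Longrightarrow> homogeneous n (f i)"
  shows "homogeneous n (sum f S)"
  using assms by (induction S rule: infinite_finite_induct) (auto simp: homogeneous_add)

lemma homogeneous_power:
  fixes f :: "'a::comm_semiring_1 poly4"
  assumes "homogeneous n f"
  shows "homogeneous (n * k) (f ^ k)"
proof (induction k)
  case 0
  show ?case by (simp add: homogeneous_def)
next
  case (Suc k)
  then show ?case using homogeneous_mult[OF assms Suc] by simp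
qed

lemma homogeneous_prod:
  fixes f :: "'b \<Rightarrow> 'a::comm_semiring_1 poly4"
  assumes "\<And>i. i \<in> S \<Longrightarrow> homogeneous (d i) (f i)"
  shows "homogeneous (sum d S) (prod f S)"
  using assms
proof (induction S rule: infinite_finite_induct)
  case (insert x F)
  then show ?case using homogeneous_mult[of "d x" "f x" "sum d F" "prod f F"] by simp
qed (simp_all add: homogeneous_def)

lemma homogeneous_lin_subst:
  assumes "homogeneous n f"
  shows "homogeneous n (lin_subst A f)"
  unfolding lin_subst_def
proof (rule homogeneous_sum)
  fix m assume m: "m \<in> Poly_Mapping.keys f"
  have "homogeneous 1 (\<Sum>j\<in>UNIV. const4 (A $ i $ j) * var4 j)" for i
    using homogeneous_mult[OF homogeneous_const4 homogeneous_var4] by (intro homogeneous_sum) simp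
  then have "homogeneous (1 * Poly_Mapping.lookup m i)
      ((\<Sum>j\<in>UNIV. const4 (A $ i $ j) * var4 j) ^ Poly_Mapping.lookup m i)" for i
    by (rule homogeneous_power)
  then have "homogeneous (monom_degree m)
      (\<Prod>i\<in>UNIV. (\<Sum>j\<in>UNIV. const4 (A $ i $ j) * var4 j) ^ Poly_Mapping.lookup m i)"
    unfolding monom_degree_def by (intro homogeneous_prod) simp
  moreover have "monom_degree m = n" using assms m by (simp add: homogeneous_def)
  ultimately show "homogeneous n (const4 (Poly_Mapping.lookup f m) *
      (\<Prod>i\<in>UNIV. (\<Sum>j\<in>UNIV. const4 (A $ i $ j) * var4 j) ^ Poly_Mapping.lookup m i))"
    using homogeneous_mult[OF homogeneous_const4] by fastforce
qed

abbreviation eval_monom :: "monom4 \<Rightarrow> 'a::comm_semiring_1 ^ 4 \<Rightarrow> 'a" where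
  "eval_monom m v \<equiv> \<Prod>i\<in>UNIV. (v $ i) ^ Poly_Mapping.lookup m i"

text \<open>Polynomials with different supports can be compared over a common index set, since
  monomials outside the support contribute 0.\<close>

lemma eval4_superset:
  assumes "finite S" "Poly_Mapping.keys f \<subseteq> S"
  shows "eval4 f v = (\<Sum>m\<in>S. Poly_Mapping.lookup f m * eval_monom m v)"
  unfolding eval4_def by (rule sum.mono_neutral_left) (use assms in \<open>auto simp: in_keys_iff\<close>)

lemma eval4_zero [simp]: "eval4 0 v = 0"
  by (simp add: eval4_def)

lemma eval4_single [simp]: "eval4 (Poly_Mapping.single m c) v = c * eval_monom m v"
  by (subst eval4_superset[of "{m}"]) auto

lemma eval4_add [simp]: "eval4 (f + g) v = eval4 f v + eval4 g v"
proof -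
  let ?S = "Poly_Mapping.keys f \<union> Poly_Mapping.keys g"
  have "eval4 (f + g) v = (\<Sum>m\<in>?S. Poly_Mapping.lookup (f + g) m * eval_monom m v)"
    by (rule eval4_superset) (auto simp: keys_add)
  moreover have "eval4 f v = (\<Sum>m\<in>?S. Poly_Mapping.lookup f m * eval_monom m v)"
    by (rule eval4_superset) auto
  moreover have "eval4 g v = (\<Sum>m\<in>?S. Poly_Mapping.lookup g m * eval_monom m v)"
    by (rule eval4_superset) auto
  ultimately show ?thesis by (simp add: lookup_add algebra_simps sum.distrib)
qed

lemma eval4_sum [simp]: "eval4 (sum f S) v = (\<Sum>i\<in>S. eval4 (f i) v)"
  by (induction S rule: infinite_finite_induct) auto

lemma poly4_eq_sum_single:
  fixes f :: "'a::comm_semiring_1 poly4"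
  shows "f = (\<Sum>m\<in>Poly_Mapping.keys f. Poly_Mapping.single m (Poly_Mapping.lookup f m))"
proof (rule poly_mapping_eqI)
  fix k
  show "Poly_Mapping.lookup f k = Poly_Mapping.lookup
      (\<Sum>m\<in>Poly_Mapping.keys f. Poly_Mapping.single m (Poly_Mapping.lookup f m)) k"
    by (simp add: lookup_sum lookup_single when_def in_keys_iff)
qed

lemma eval4_mult [simp]: "eval4 (f * g) v = eval4 f v * eval4 g v"
proof -
  let ?s = "\<lambda>f m. Poly_Mapping.single m (Poly_Mapping.lookup f m)"
  have "eval4 (f * g) v = eval4 (sum (?s f) (Poly_Mapping.keys f) * sum (?s g) (Poly_Mapping.keys g)) v"
    using poly4_eq_sum_single[of f] poly4_eq_sum_single[of g] by simp
  also have "\<dots> = (\<Sum>m\<in>Poly_Mapping.keys f. \<Sum>n\<in>Poly_Mapping.keys g.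
      (Poly_Mapping.lookup f m * eval_monom m v) * (Poly_Mapping.lookup g n * eval_monom n v))"
    by (simp add: sum_product mult_single lookup_add power_add prod.distrib ac_simps)
  also have "\<dots> = eval4 f v * eval4 g v"
    by (simp add: eval4_def sum_product)
  finally show ?thesis .
qed

lemma eval4_one [simp]: "eval4 1 v = 1"
  using eval4_single[of 0 1 v] by (simp del: eval4_single)

lemma eval4_power [simp]: "eval4 (f ^ n) v = eval4 f v ^ n"
  by (induction n) auto

lemma eval4_prod [simp]: "eval4 (prod f S) v = (\<Prod>i\<in>S. eval4 (f i) v)"
  by (induction S rule: infinite_finite_induct) auto

lemma eval4_const4 [simp]: "eval4 (const4 c) v = c"
  by (simp add: const4_def)

lemma eval_monom_single: "eval_monom (Poly_Mapping.single i n) v = (v $ i) ^ n"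
proof -
  have "eval_monom (Poly_Mapping.single i n) v = (\<Prod>j\<in>UNIV. if j = i then (v $ i) ^ n else 1)"
    by (rule prod.cong) (auto simp: lookup_single when_def)
  then show ?thesis by simp
qed

lemma eval4_var4 [simp]: "eval4 (var4 i) v = v $ i"
  by (simp add: var4_def eval_monom_single)

lemma eval4_lin_subst: "eval4 (lin_subst A f) v = eval4 f (A *v v)"
  by (simp add: lin_subst_def) (simp add: eval4_def matrix_vector_mult_def)

text \<open>Dividing by \<open>x_k\<close> leaves degree 1, and dividing once more leaves degree 0.
  The first factor is prescribed, as needed when asking whether a given indeterminate
  occurs.\<close>

lemma monom_degree_2E:
  assumes "monom_degree m = 2" "k \<in> Poly_Mapping.keys m"
  obtains j where "m = Poly_Mapping.single k 1 + Poly_Mapping.single j 1"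
proof -
  define n where "n = m - Poly_Mapping.single k 1"
  have m: "m = Poly_Mapping.single k 1 + n"
    using assms(2) by (auto simp: n_def lookup_add lookup_minus lookup_single when_def in_keys_iff
        intro!: poly_mapping_eqI)
  then have n1: "monom_degree n = 1" using assms(1) by (simp add: monom_degree_add)
  then have "n \<noteq> 0" by auto
  then obtain j where j: "j \<in> Poly_Mapping.keys n" by (metis keys_eq_empty ex_in_conv)
  define l where "l = n - Poly_Mapping.single j 1"
  have n: "n = Poly_Mapping.single j 1 + l"
    using j by (auto simp: l_def lookup_add lookup_minus lookup_single when_def in_keys_iff
        intro!: poly_mapping_eqI)
  then have "monom_degree l = 0" using n1 by (simp add: monom_degree_add)
  then show ?thesis using that m n by (simp add: monom_degree_eq_0_iff)
qed

lemma monom_degree_2_cases: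
  assumes "monom_degree m = 2"
  obtains i j where "m = Poly_Mapping.single i 1 + Poly_Mapping.single j 1"
proof -
  have "m \<noteq> 0" using assms by auto
  then obtain k where "k \<in> Poly_Mapping.keys m" by (metis keys_eq_empty ex_in_conv)
  then show ?thesis using monom_degree_2E assms that by metis
qed

section \<open>Quadratic maps and their polar forms\<close>

definition polar :: "('a::field ^ 'n \<Rightarrow> 'a) \<Rightarrow> 'a ^ 'n \<Rightarrow> 'a ^ 'n \<Rightarrow> 'a" where
  "polar F v w = F (v + w) - F v - F w"

text \<open>The coordinate-free notion of a quadratic form. The polar form carries no factor 1/2, so
  characteristic 2 is covered; its linearity in the second argument follows by symmetry.\<close>

locale quadratic_map =
  fixes F :: "'a::field ^ 'n \<Rightarrow> 'a"
  assumes scale: "F (c *s v) = c\<^sup>2 * F v"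
    and polar_add: "polar F (u + v) w = polar F u w + polar F v w"
    and polar_scale: "polar F (c *s v) w = c * polar F v w"
begin

lemma polar_commute: "polar F v w = polar F w v"
  by (simp add: polar_def add.commute)

lemma polar_add_right: "polar F w (u + v) = polar F w u + polar F w v"
  by (metis polar_commute polar_add)

lemma polar_scale_right: "polar F w (c *s v) = c * polar F w v"
  by (metis polar_commute polar_scale)

lemma at_zero [simp]: "F 0 = 0"
  using scale[of 0 0] by simp

lemma at_add: "F (v + w) = F v + F w + polar F v w"
  by (simp add: polar_def)

text \<open>\<open>F (2 *s v) = 4 * F v\<close>, from which \<open>F v\<close> is subtracted twice.
  In characteristic 2 the polar form is therefore alternating.\<close>

lemma polar_self: "polar F v v = 2 * F v"
proof -
  have "v + v = 2 *s v" by (metis one_add_one vector_sadd_rdistrib vector_smult_lid)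
  then have "F (v + v) = 2\<^sup>2 * F v" using scale by metis
  then show ?thesis by (simp add: polar_def)
qed

lemmas expand = at_add scale polar_add polar_add_right polar_scale polar_scale_right

end

lemma quadratic_map_zero: "quadratic_map (\<lambda>v. 0)"
  by unfold_locales (simp_all add: polar_def)

lemma quadratic_map_add:
  assumes "quadratic_map F" "quadratic_map G"
  shows "quadratic_map (\<lambda>v. F v + G v)"
proof -
  have *: "polar (\<lambda>v. F v + G v) v w = polar F v w + polar G v w" for v w
    by (simp add: polar_def)
  show ?thesis
    using assms by unfold_locales
      (simp_all add: * quadratic_map.scale quadratic_map.polar_add quadratic_map.polar_scale algebra_simps)
qed

lemma quadratic_map_sum:
  assumes "\<And>i. i \<in> S \<Longrightarrow> quadratic_map (F i)"
  shows "quadratic_map (\<lambda>v. \<Sum>i\<in>S. F i v)"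
  using assms
  by (induction S rule: infinite_finite_induct) (auto simp: quadratic_map_zero quadratic_map_add)

lemma quadratic_map_monom: "quadratic_map (\<lambda>v. c * (v $ i * v $ j))"
  by unfold_locales (simp_all add: polar_def algebra_simps power2_eq_square)

lemma quadratic_map_eval4:
  fixes f :: "'a::field poly4"
  assumes "homogeneous 2 f"
  shows "quadratic_map (eval4 f)"
proof -
  have "quadratic_map (\<lambda>v. Poly_Mapping.lookup f m * eval_monom m v)" if "m \<in> Poly_Mapping.keys f" for m
  proof -
    have "monom_degree m = 2" using assms that by (simp add: homogeneous_def)
    then obtain i j where "m = Poly_Mapping.single i 1 + Poly_Mapping.single j 1"
      by (rule monom_degree_2_cases)
    then have "eval_monom m v = v $ i * v $ j" for v :: "'a ^ 4"
      by (simp add: lookup_add power_add prod.distrib eval_monom_single)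
    then show ?thesis by (simp add: quadratic_map_monom)
  qed
  then show ?thesis unfolding eval4_def by (rule quadratic_map_sum)
qed

text \<open>At the i-th unit vector every monomial of degree 2 other than the square of
  \<open>x_i\<close> vanishes.\<close>

lemma homogeneous_2_coeff_square:
  fixes f :: "'a::field poly4"
  assumes "homogeneous 2 f"
  shows "eval4 f (axis i 1) = Poly_Mapping.lookup f (Poly_Mapping.single i 1 + Poly_Mapping.single i 1)"
proof -
  let ?m = "Poly_Mapping.single i 1 + Poly_Mapping.single i 1"
  have "Poly_Mapping.lookup f m * eval_monom m (axis i 1) =
      (if m = ?m then Poly_Mapping.lookup f ?m else 0)"
    if "m \<in> Poly_Mapping.keys f" for m
  proof (cases "m = ?m")
    case True
    then show ?thesis by (simp add: lookup_add power_add prod.distrib eval_monom_single)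
  next
    case False
    have "monom_degree m = 2" using assms that by (simp add: homogeneous_def)
    then obtain k l where m: "m = Poly_Mapping.single k 1 + Poly_Mapping.single l 1"
      by (rule monom_degree_2_cases)
    then have "k \<noteq> i \<or> l \<noteq> i" using False by auto
    moreover have ev: "eval_monom m v = v $ k * v $ l" for v :: "'a ^ 4"
      by (simp add: m lookup_add power_add prod.distrib eval_monom_single)
    ultimately have "eval_monom m (axis i (1::'a)) = 0"
      unfolding ev by (auto simp: axis_def)
    then show ?thesis using False by simp
  qed
  then have "eval4 f (axis i 1) = (\<Sum>m\<in>Poly_Mapping.keys f. if m = ?m then Poly_Mapping.lookup f ?m else 0)"
    unfolding eval4_def by (rule sum.cong[OF refl])
  then show ?thesis by (auto simp: in_keys_iff)
qed

text \<open>The polar form of \<open>x_k x_l\<close> at the unit vectors i and j is 1 if the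
  unordered pairs {k, l} and {i, j} agree, and 0 otherwise.\<close>

lemma homogeneous_2_coeff_mixed:
  fixes f :: "'a::field poly4"
  assumes "homogeneous 2 f" "i \<noteq> j"
  shows "polar (eval4 f) (axis i 1) (axis j 1) =
    Poly_Mapping.lookup f (Poly_Mapping.single i 1 + Poly_Mapping.single j 1)"
proof -
  let ?m = "Poly_Mapping.single i 1 + Poly_Mapping.single j (1::nat)"
  let ?i = "axis i 1 :: 'a ^ 4" and ?j = "axis j 1 :: 'a ^ 4"
  have "Poly_Mapping.lookup f m * (eval_monom m (?i + ?j) - eval_monom m ?i - eval_monom m ?j) =
      (if m = ?m then Poly_Mapping.lookup f ?m else 0)"
    if "m \<in> Poly_Mapping.keys f" for m
  proof -
    have "monom_degree m = 2" using assms that by (simp add: homogeneous_def)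
    then obtain k l where m: "m = Poly_Mapping.single k 1 + Poly_Mapping.single l 1"
      by (rule monom_degree_2_cases)
    have m_iff: "m = ?m \<longleftrightarrow> k = i \<and> l = j \<or> k = j \<and> l = i"
    proof
      assume "m = ?m"
      then have "Poly_Mapping.lookup m x = Poly_Mapping.lookup ?m x" for x by simp
      from this[of i] this[of j] this[of k] show "k = i \<and> l = j \<or> k = j \<and> l = i"
        using assms(2) by (auto simp: m lookup_add lookup_single when_def split: if_splits)
    qed (auto simp: m add.commute)
    have ev: "eval_monom m v = v $ k * v $ l" for v :: "'a ^ 4"
      by (simp add: m lookup_add power_add prod.distrib eval_monom_single)
    have diff: "eval_monom m (?i + ?j) - eval_monom m ?i - eval_monom m ?j =
        (if k = i \<and> l = j \<or> k = j \<and> l = i then 1 else 0)"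
      unfolding ev using assms(2) by (auto simp: axis_def)
    show ?thesis
    proof (cases "m = ?m")
      case True
      then show ?thesis
        unfolding diff if_P[OF True] if_P[OF m_iff[THEN iffD1, OF True]] by (simp only: mult_1_right)
    next
      case False
      then have "\<not> (k = i \<and> l = j \<or> k = j \<and> l = i)" using m_iff by blast
      then show ?thesis unfolding diff if_not_P[OF False] by (simp only: if_not_P mult_zero_right if_False)
    qed
  qed
  then have "polar (eval4 f) ?i ?j =
      (\<Sum>m\<in>Poly_Mapping.keys f. if m = ?m then Poly_Mapping.lookup f ?m else 0)"
    unfolding eval4_def polar_def sum_subtractf[symmetric]
    by (intro sum.cong[OF refl]) (simp add: right_diff_distrib)
  then show ?thesis by (auto simp: in_keys_iff)
qed

text \<open>Over a finite field a nonzero polynomial may vanish everywhere, but in degree 2 all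
  coefficients are values of the form or of its polar form at unit vectors.\<close>

lemma homogeneous_2_eval4_eq_0:
  fixes f :: "'a::field poly4"
  assumes "homogeneous 2 f" "\<And>v. eval4 f v = 0"
  shows "f = 0"
proof (rule ccontr)
  assume "f \<noteq> 0"
  then obtain m where m: "m \<in> Poly_Mapping.keys f" by (metis keys_eq_empty ex_in_conv)
  then have "monom_degree m = 2" using assms by (simp add: homogeneous_def)
  then obtain k l where "m = Poly_Mapping.single k 1 + Poly_Mapping.single l 1"
    by (rule monom_degree_2_cases)
  then have "Poly_Mapping.lookup f m = 0"
    using homogeneous_2_coeff_square[OF assms(1), of k] homogeneous_2_coeff_mixed[OF assms(1), of k l] assms(2)
    by (cases "k = l") (auto simp: polar_def)
  then show False using m by (simp add: in_keys_iff)
qed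

text \<open>The coefficients of the monomials containing \<open>x_k\<close> are the value at the
  k-th unit vector and its polar values with the others. The value is a separate condition because
  in characteristic 2 the polar form does not see squares.\<close>

lemma homogeneous_2_indeterminate_radical:
  fixes f :: "'a::field poly4"
  assumes f: "homogeneous 2 f"
    and k: "eval4 f (axis k 1) = 0" "\<And>v. polar (eval4 f) (axis k 1) v = 0"
  shows "k \<notin> indeterminates f"
proof
  assume "k \<in> indeterminates f"
  then obtain m where m: "m \<in> Poly_Mapping.keys f" "k \<in> Poly_Mapping.keys m"
    by (auto simp: indeterminates_def)
  then have "monom_degree m = 2" using f by (simp add: homogeneous_def)
  then obtain l where "m = Poly_Mapping.single k 1 + Poly_Mapping.single l 1"
    using m(2) by (rule monom_degree_2E)
  then have "Poly_Mapping.lookup f m = 0"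
    using homogeneous_2_coeff_square[OF f, of k] homogeneous_2_coeff_mixed[OF f, of k l] k
    by (cases "k = l") auto
  then show False using m by (simp add: in_keys_iff)
qed

section \<open>The rank and the radical of a form\<close>

lemma eval4_cong_indeterminates:
  assumes "\<And>i. i \<in> indeterminates f \<Longrightarrow> v $ i = w $ i"
  shows "eval4 f v = eval4 f w"
  unfolding eval4_def
proof (intro sum.cong refl arg_cong2[where f = "(*)"] prod.cong)
  fix m i assume m: "m \<in> Poly_Mapping.keys f"
  show "(v $ i) ^ Poly_Mapping.lookup m i = (w $ i) ^ Poly_Mapping.lookup m i"
  proof (cases "i \<in> Poly_Mapping.keys m")
    case True
    then have "i \<in> indeterminates f" using m unfolding indeterminates_def by blast
    then show ?thesis by (simp add: assms)
  qed (simp add: not_in_keys_iff_lookup_eq_zero)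
qed

text \<open>Adding a second radical direction \<open>r\<close> as a column of the coordinate change would
  eliminate a further indeterminate.\<close>

lemma form_rank_3_radical:
  fixes f :: "'a::field poly4"
  assumes f: "homogeneous 2 f" and rank: "form_rank f = 3"
  obtains A :: "'a^4^4" and k where "invertible A"
    "eval4 f (column k A) = 0" "\<And>v. polar (eval4 f) (column k A) v = 0"
    "\<And>r. eval4 f r = 0 \<Longrightarrow> (\<And>v. polar (eval4 f) r v = 0) \<Longrightarrow> \<exists>c. r = c *s column k A"
proof -
  let ?P = "\<lambda>r. \<exists>A::'a^4^4. invertible A \<and> card (indeterminates (lin_subst A f)) = r"
  \<comment> \<open>The identity matrix shows that some value is attained, so the
    \<open>LEAST\<close> in \<open>form_rank\<close> is a genuine minimum.\<close>
  have "?P (card (indeterminates (lin_subst (mat 1 :: 'a^4^4) f)))"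
    unfolding invertible_def using matrix_mul_lid by blast
  then have "?P (form_rank f)" unfolding form_rank_def by (rule LeastI)
  then obtain A :: "'a^4^4" where A: "invertible A" "card (indeterminates (lin_subst A f)) = 3"
    unfolding rank by blast
  have rank_le: "3 \<le> card (indeterminates (lin_subst A' f))" if "invertible A'" for A'
    using that unfolding rank[symmetric] form_rank_def by (intro Least_le) blast
  have "indeterminates (lin_subst A f) \<noteq> UNIV" using A(2) by auto
  then obtain k where k: "k \<notin> indeterminates (lin_subst A f)" by blast
  let ?u = "column k A"
  interpret quadratic_map "eval4 f" using f by (rule quadratic_map_eval4)
  have A_axis: "A *v axis i c = c *s column i A" for A :: "'a^4^4" and i c
    by (simp add: matrix_vector_mult_basis[symmetric] axis_def matrix_vector_mult_def column_def vec_eq_iff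
      if_distrib cong: if_cong)
  \<comment> \<open>Since \<open>x_k\<close> does not occur after the substitution, moving along
    \<open>?u\<close> does not change the value; hence \<open>?u\<close> lies in the
    radical.\<close>
  have shift: "eval4 f (A *v (axis k 1 + x)) = eval4 f (A *v x)" for x
    using eval4_cong_indeterminates[of "lin_subst A f" "axis k 1 + x" x] k
    by (force simp: eval4_lin_subst axis_def)
  have inj: "A *v x = 0 \<Longrightarrow> x = 0" for x
    using A(1) by (metis invertible_left_inverse matrix_left_invertible_ker)
  have surj: "\<exists>x. v = A *v x" for v
    using A(1) by (metis invertible_right_inverse matrix_right_invertible_surjective surjD)
  have u: "eval4 f ?u = 0" using shift[of 0] A_axis[of A k 1] by simp
  have polar_u: "polar (eval4 f) ?u v = 0" for v
  proof -
    obtain x where "v = A *v x" using surj by blast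
    then show ?thesis
      using shift[of x] A_axis[of A k 1] u by (simp add: polar_def matrix_vector_right_distrib)
  qed
  have rad: "\<exists>c. r = c *s ?u" if r: "eval4 f r = 0" "\<And>v. polar (eval4 f) r v = 0" for r
  proof (rule ccontr)
    assume not: "\<nexists>c. r = c *s ?u"
    obtain \<rho> where \<rho>: "r = A *v \<rho>" using surj by blast
    have "\<rho> \<noteq> axis k (\<rho> $ k)" using not \<rho> A_axis by metis
    then obtain l where l: "\<rho> $ l \<noteq> axis k (\<rho> $ k) $ l" by (auto simp: vec_eq_iff)
    then have lk: "l \<noteq> k" and \<rho>l: "\<rho> $ l \<noteq> 0" by (auto simp: axis_def split: if_splits)
    define A' :: "'a^4^4" where "A' = (\<chi> i j. if j = l then r $ i else A $ i $ j)"
    have col: "column l A' = r" "column k A' = ?u"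
      using lk by (auto simp: A'_def column_def vec_eq_iff)
    \<comment> \<open>This exhibits \<open>A'\<close> as \<open>A\<close> after a linear map that
      multiplies the l-th coordinate by \<open>\<rho> $ l\<close>. As that factor is nonzero,
      \<open>A'\<close> inherits injectivity from \<open>A\<close>.\<close>
    have A'_eq: "A' *v x = A *v (x + x $ l *s (\<rho> - axis l 1))" for x
    proof -
      have "A' *v x = A *v x + x $ l *s (r - column l A)"
      proof (subst vec_eq_iff, intro allI)
        fix i
        have "(A' *v x) $ i = (\<Sum>j\<in>UNIV. A $ i $ j * x $ j + (if j = l then (r $ i - A $ i $ l) * x $ l else 0))"
          unfolding matrix_vector_mult_def A'_def by (auto intro!: sum.cong simp: algebra_simps)
        then show "(A' *v x) $ i = (A *v x + x $ l *s (r - column l A)) $ i"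
          by (simp add: sum.distrib matrix_vector_mult_def column_def algebra_simps)
      qed
      then show ?thesis
        using A_axis[of A l 1]
        by (simp add: \<rho> matrix_vector_right_distrib matrix_vector_mult_diff_distrib vector_scalar_commute)
    qed
    have "x = 0" if "A' *v x = 0" for x
    proof -
      have *: "x + x $ l *s (\<rho> - axis l 1) = 0" using that inj A'_eq by metis
      then have "(x + x $ l *s (\<rho> - axis l 1)) $ l = 0" by simp
      then have "x $ l * \<rho> $ l = 0" by (simp add: algebra_simps)
      with \<rho>l * show ?thesis by simp
    qed
    then have A': "invertible A'"
      by (metis invertible_left_inverse matrix_left_invertible_ker)
    let ?h = "lin_subst A' f"
    have h: "homogeneous 2 ?h" using f by (rule homogeneous_lin_subst)
    have eval_h: "eval4 ?h x = eval4 f (A' *v x)" for x by (rule eval4_lin_subst)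
    have polar_h: "polar (eval4 ?h) x y = polar (eval4 f) (A' *v x) (A' *v y)" for x y
      by (simp add: polar_def eval_h matrix_vector_right_distrib)
    have "k \<notin> indeterminates ?h" "l \<notin> indeterminates ?h"
      by (rule homogeneous_2_indeterminate_radical[OF h]; simp add: eval_h polar_h A_axis col u polar_u r)+
    then have "indeterminates ?h \<subseteq> UNIV - {k, l}" by blast
    then have "card (indeterminates ?h) \<le> card (UNIV - {k, l})" by (intro card_mono) auto
    also have "\<dots> = 2" using lk by (simp add: card_Diff_subset)
    finally show False using rank_le[OF A'] by simp
  qed
  show ?thesis by (rule that[OF A(1) u polar_u rad])
qed

subsection \<open>Normal form of a quadric cone\<close>

text \<open>Each square has at most two roots, and 0 has only one, which makes the inequality strict
  in every characteristic.\<close>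

lemma card_range_square: "CARD('a) < 2 * card (range (\<lambda>x :: 'a::{field,finite}. x\<^sup>2))"
proof -
  let ?S = "range (\<lambda>x :: 'a. x\<^sup>2)"
  have fibre: "card {x :: 'a. x\<^sup>2 = s} \<le> (if s = 0 then 1 else 2)" if s: "s \<in> ?S" for s
  proof -
    obtain y where s: "s = y\<^sup>2" using s by auto
    then have "{x. x\<^sup>2 = s} = {y, - y}" by (auto simp: power2_eq_iff)
    then show ?thesis using s by (auto simp: card_insert_if)
  qed
  have "(\<Union>s\<in>?S. {x :: 'a. x\<^sup>2 = s}) = UNIV" by auto
  then have "CARD('a) = card (\<Union>s\<in>?S. {x :: 'a. x\<^sup>2 = s})" by simp
  also have "\<dots> \<le> (\<Sum>s\<in>?S. card {x :: 'a. x\<^sup>2 = s})" by (rule card_UN_le) simp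
  also have "\<dots> \<le> (\<Sum>s\<in>?S. if s = 0 then 1 else 2)" by (rule sum_mono[OF fibre])
  also have "\<dots> < (\<Sum>s\<in>?S. 2)" by (rule sum_strict_mono_ex1) (auto intro!: bexI[of _ 0])
  finally show ?thesis by simp
qed

text \<open>The values of \<alpha> a^2 and of -\<beta> b^2 - \<gamma> each fill more than half of
  the field, so the two sets meet.\<close>

lemma binary_diagonal_form_universal:
  fixes \<alpha> \<beta> \<gamma> :: "'a::{field,finite}"
  assumes "\<alpha> \<noteq> 0" "\<beta> \<noteq> 0"
  obtains a b where "\<alpha> * a\<^sup>2 + \<beta> * b\<^sup>2 + \<gamma> = 0"
proof -
  let ?S = "range (\<lambda>x :: 'a. x\<^sup>2)"
  let ?f = "\<lambda>s. \<alpha> * s" and ?g = "\<lambda>s. - \<beta> * s - \<gamma>"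
  have "card (?f ` ?S) = card ?S" "card (?g ` ?S) = card ?S"
    using assms by (auto intro!: card_image inj_onI)
  then have "\<not> card (?f ` ?S) + card (?g ` ?S) \<le> CARD('a)"
    using card_range_square[where 'a='a] by simp
  then have "?f ` ?S \<inter> ?g ` ?S \<noteq> {}"
    by (metis card_Un_disjoint card_mono finite finite_class.finite_UNIV subset_UNIV)
  then obtain a b where "\<alpha> * a\<^sup>2 = - \<beta> * b\<^sup>2 - \<gamma>" by blast
  then show ?thesis using that[of a b] by simp
qed

text \<open>Here x^2 = y^2 forces x = y, so squaring is injective, and on a finite field also
  surjective.\<close>

lemma char_2_square_root:
  fixes s :: "'a::{field,finite}"
  assumes "(2::'a) = 0"
  obtains x where "x\<^sup>2 = s"
proof -
  have "- x = x" for x :: 'a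
    using assms by (metis add_eq_0_iff mult_2 mult_zero_left)
  then have "inj (\<lambda>x :: 'a. x\<^sup>2)" by (auto intro!: injI simp: power2_eq_iff)
  then have "surj (\<lambda>x :: 'a. x\<^sup>2)" by (simp add: finite_UNIV_inj_surj)
  then show ?thesis using that by (metis surjD)
qed

lemma ternary_form_isotropic_char_2:
  fixes \<alpha> \<beta> \<gamma> \<delta> \<epsilon> \<zeta> :: "'a::{field,finite}"
  assumes two: "(2::'a) = 0"
  shows "\<exists>x y z. (x, y, z) \<noteq> (0, 0, 0) \<and>
    \<alpha> * x\<^sup>2 + \<beta> * y\<^sup>2 + \<gamma> * z\<^sup>2 + \<delta> * x * y + \<epsilon> * x * z + \<zeta> * y * z = 0"
proof -
  let ?Q = "\<lambda>x y z. \<alpha> * x\<^sup>2 + \<beta> * y\<^sup>2 + \<gamma> * z\<^sup>2 + \<delta> * x * y + \<epsilon> * x * z + \<zeta> * y * z"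
  have double: "a + a = 0" for a :: 'a using two by (metis mult_2 mult_zero_left)
  show ?thesis
  proof (cases "\<delta> = 0 \<and> \<epsilon> = 0 \<and> \<zeta> = 0")
    case True
    obtain a where a: "a\<^sup>2 = \<alpha>" using char_2_square_root[OF two] .
    obtain b where b: "b\<^sup>2 = \<beta>" using char_2_square_root[OF two] .
    show ?thesis
    proof (cases "a = 0")
      case True
      then show ?thesis using a \<open>\<delta> = 0 \<and> \<epsilon> = 0 \<and> \<zeta> = 0\<close> by (intro exI[of _ 1] exI[of _ 0]) auto
    next
      case False
      \<comment> \<open>The form takes the value a^2 b^2 + b^2 a^2 = 0 at (b, a, 0).\<close>
      then show ?thesis using a b True double[of "a\<^sup>2 * b\<^sup>2"]
        by (intro exI[of _ b] exI[of _ a] exI[of _ 0]) (auto simp: ac_simps)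
    qed
  next
    case False
    \<comment> \<open>\<open>(\<zeta>, \<epsilon>, \<delta>)\<close> spans the radical of the alternating form polar to \<open>?Q\<close>.\<close>
    let ?r = "?Q \<zeta> \<epsilon> \<delta>"
    show ?thesis
    proof (cases "?r = 0")
      case True
      then show ?thesis using False by (intro exI[of _ \<zeta>] exI[of _ \<epsilon>] exI[of _ \<delta>]) auto
    next
      case r: False
      \<comment> \<open>The scalars \<open>c\<close> and \<open>d\<close> make the first and second
        unit vectors singular after adding \<open>c\<close> or \<open>d\<close> times the radical
        vector; the cross terms in \<open>Q1\<close> and \<open>Q2\<close> are multiples of
        2.\<close>
      obtain c where "c\<^sup>2 = - \<alpha> / ?r" using char_2_square_root[OF two] .
      then have c: "\<alpha> + c\<^sup>2 * ?r = 0" using r by simp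
      obtain d where "d\<^sup>2 = - \<beta> / ?r" using char_2_square_root[OF two] .
      then have d: "\<beta> + d\<^sup>2 * ?r = 0" using r by simp
      have Q1: "?Q (1 + c * \<zeta>) (c * \<epsilon>) (c * \<delta>) = \<alpha> + c\<^sup>2 * ?r + c * (2 * (\<alpha> * \<zeta> + \<delta> * \<epsilon>))"
        by (simp add: algebra_simps power2_eq_square)
      have Q2: "?Q (d * \<zeta>) (1 + d * \<epsilon>) (d * \<delta>) = \<beta> + d\<^sup>2 * ?r + d * (2 * (\<beta> * \<epsilon> + \<zeta> * \<delta>))"
        by (simp add: algebra_simps power2_eq_square)
      show ?thesis
      \<comment> \<open>The first candidate is zero only if the radical vector is proportional to
        the first unit vector. Then \<epsilon> = 0, and the second candidate has middle coordinate
        1.\<close>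
      proof (cases "(1 + c * \<zeta>, c * \<epsilon>, c * \<delta>) = (0, 0, 0)")
        case True
        then have "1 + d * \<epsilon> \<noteq> 0" by auto
        moreover have "?Q (d * \<zeta>) (1 + d * \<epsilon>) (d * \<delta>) = 0" using Q2 d two by simp
        ultimately show ?thesis
          by - (rule exI[of _ "d * \<zeta>"], rule exI[of _ "1 + d * \<epsilon>"], rule exI[of _ "d * \<delta>"], simp)
      next
        case False
        then show ?thesis
          using Q1 c two by (intro exI[of _ "1 + c * \<zeta>"] exI[of _ "c * \<epsilon>"] exI[of _ "c * \<delta>"]) simp
      qed
    qed
  qed
qed

text \<open>Completing the square in x and then in y, with z = 1, reduces the equation to a diagonal
  binary form taking a prescribed value. A vanishing leading coefficient at either stage gives a
  zero directly.\<close>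

lemma ternary_form_isotropic_odd:
  fixes \<alpha> \<beta> \<gamma> \<delta> \<epsilon> \<zeta> :: "'a::{field,finite}"
  assumes two: "(2::'a) \<noteq> 0"
  shows "\<exists>x y z. (x, y, z) \<noteq> (0, 0, 0) \<and>
    \<alpha> * x\<^sup>2 + \<beta> * y\<^sup>2 + \<gamma> * z\<^sup>2 + \<delta> * x * y + \<epsilon> * x * z + \<zeta> * y * z = 0"
proof -
  let ?Q = "\<lambda>x y z. \<alpha> * x\<^sup>2 + \<beta> * y\<^sup>2 + \<gamma> * z\<^sup>2 + \<delta> * x * y + \<epsilon> * x * z + \<zeta> * y * z"
  have four: "(4::'a) \<noteq> 0" using two by (metis mult_2 mult_eq_0_iff numeral_Bit0)
  show ?thesis
  proof (cases "\<alpha> = 0")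
    case True
    then show ?thesis by (intro exI[of _ 1] exI[of _ 0]) auto
  next
    case \<alpha>: False
    define \<beta>' \<gamma>' \<zeta>' where "\<beta>' = 4 * \<alpha> * \<beta> - \<delta>\<^sup>2" and "\<gamma>' = 4 * \<alpha> * \<gamma> - \<epsilon>\<^sup>2"
      and "\<zeta>' = 4 * \<alpha> * \<zeta> - 2 * \<delta> * \<epsilon>"
    have square: "4 * \<alpha> * ?Q x y z = (2 * \<alpha> * x + \<delta> * y + \<epsilon> * z)\<^sup>2 + \<beta>' * y\<^sup>2 + \<gamma>' * z\<^sup>2 + \<zeta>' * y * z" for x y z
      by (simp add: \<beta>'_def \<gamma>'_def \<zeta>'_def algebra_simps power2_eq_square)
    show ?thesis
    proof (cases "\<beta>' = 0")
      case True
      have "4 * \<alpha> * ?Q (- \<delta> / (2 * \<alpha>)) 1 0 = 0"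
        unfolding square using True two \<alpha> by simp
      then have "?Q (- \<delta> / (2 * \<alpha>)) 1 0 = 0" using \<alpha> four by (metis mult_eq_0_iff)
      then show ?thesis by (intro exI[of _ "- \<delta> / (2 * \<alpha>)"] exI[of _ 1] exI[of _ 0]) simp
    next
      case \<beta>': False
      have "4 * \<beta>' \<noteq> 0" using four \<beta>' by simp
      then obtain a b where ab: "4 * \<beta>' * a\<^sup>2 + 1 * b\<^sup>2 + (4 * \<beta>' * \<gamma>' - \<zeta>'\<^sup>2) = 0"
        using binary_diagonal_form_universal[of "4 * \<beta>'" 1] by (metis zero_neq_one)
      \<comment> \<open>\<open>y\<close> and \<open>x\<close> undo the two substitutions:
        \<open>b\<close> is the completed square term in y, and \<open>a\<close> the one in
        x.\<close>
      define y where "y = (b - \<zeta>') / (2 * \<beta>')"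
      define x where "x = (a - \<delta> * y - \<epsilon>) / (2 * \<alpha>)"
      have b: "b = 2 * \<beta>' * y + \<zeta>'" using \<beta>' two by (simp add: y_def)
      have a: "a = 2 * \<alpha> * x + \<delta> * y + \<epsilon>" using \<alpha> two by (simp add: x_def)
      have "4 * \<beta>' * (4 * \<alpha> * ?Q x y 1) = 4 * \<beta>' * (a\<^sup>2 + \<beta>' * y\<^sup>2 + \<gamma>' + \<zeta>' * y)"
        unfolding square a by simp
      also have "\<dots> = 4 * \<beta>' * a\<^sup>2 + 1 * b\<^sup>2 + (4 * \<beta>' * \<gamma>' - \<zeta>'\<^sup>2)"
        unfolding b by (simp add: algebra_simps power2_eq_square)
      finally have "4 * \<beta>' * (4 * \<alpha> * ?Q x y 1) = 0" using ab by simp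
      then have "?Q x y 1 = 0" using four \<alpha> \<beta>' by (metis mult_eq_0_iff)
      then show ?thesis by (intro exI[of _ x] exI[of _ y] exI[of _ 1]) simp
    qed
  qed
qed

lemma ternary_form_isotropic:
  fixes \<alpha> \<beta> \<gamma> \<delta> \<epsilon> \<zeta> :: "'a::{field,finite}"
  obtains x y z where "(x, y, z) \<noteq> (0, 0, 0)"
    "\<alpha> * x\<^sup>2 + \<beta> * y\<^sup>2 + \<gamma> * z\<^sup>2 + \<delta> * x * y + \<epsilon> * x * z + \<zeta> * y * z = 0"
  using ternary_form_isotropic_char_2[of \<alpha> \<beta> \<gamma> \<delta> \<epsilon> \<zeta>] ternary_form_isotropic_odd[of \<alpha> \<beta> \<gamma> \<delta> \<epsilon> \<zeta>] by blast

text \<open>A singular vector outside the radical line extends to a hyperbolic pair; a vector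
  orthogonal to the pair and independent of it and \<open>u\<close> completes the basis.\<close>

lemma cone_normal_form:
  fixes F :: "'a::{field,finite} ^ 4 \<Rightarrow> 'a" and A :: "'a ^ 4 ^ 4"
  assumes F: "quadratic_map F" and A: "invertible A" and u_def: "u = column k A"
    and u: "F u = 0" "\<And>v. polar F u v = 0"
    and rad: "\<And>r. F r = 0 \<Longrightarrow> (\<And>v. polar F r v = 0) \<Longrightarrow> \<exists>c. r = c *s u"
  obtains e w z y where "e \<noteq> 0"
    "bij (\<lambda>(a, b, c, d). a *s w + b *s z + c *s y + d *s u)"
    "\<And>a b c d. F (a *s w + b *s z + c *s y + d *s u) = e * (c\<^sup>2 - a * b)"
proof -
  interpret quadratic_map F by (rule F)
  have u': "polar F v u = 0" for v using u(2) polar_commute by metis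
  have inj: "A *v x = 0 \<Longrightarrow> x = 0" for x
    using A by (metis invertible_left_inverse matrix_left_invertible_ker)
  \<comment> \<open>The three other columns of \<open>A\<close> span a complement of
    \<open>u\<close>, so an isotropic vector of the restricted ternary form cannot be a multiple of
    \<open>u\<close>.\<close>
  have "card (UNIV - {k}) = 3" by (simp add: card_Diff_subset)
  then obtain i j l where ijl: "UNIV - {k} = {i, j, l}" "i \<noteq> j" "j \<noteq> l" "i \<noteq> l" by (metis card_3_iff)
  then have ijlk: "i \<noteq> k" "j \<noteq> k" "l \<noteq> k" by auto
  have A_axis: "A *v axis n c = c *s column n A" for n c
    by (simp add: axis_def matrix_vector_mult_def column_def vec_eq_iff if_distrib cong: if_cong)
  let ?c = "\<lambda>n. column n A"
  obtain x1 x2 x3 where x: "(x1, x2, x3) \<noteq> (0, 0, 0)"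
    "F (?c i) * x1\<^sup>2 + F (?c j) * x2\<^sup>2 + F (?c l) * x3\<^sup>2 + polar F (?c i) (?c j) * x1 * x2
      + polar F (?c i) (?c l) * x1 * x3 + polar F (?c j) (?c l) * x2 * x3 = 0"
    by (rule ternary_form_isotropic)
  define w where "w = x1 *s ?c i + x2 *s ?c j + x3 *s ?c l"
  have Fw: "F w = 0" using x(2) unfolding w_def by (simp add: expand algebra_simps)
  have "w \<noteq> c *s u" for c
  proof
    assume "w = c *s u"
    then have "A *v (axis i x1 + axis j x2 + axis l x3 - axis k c) = 0"
      by (simp add: matrix_vector_right_distrib matrix_vector_mult_diff_distrib A_axis w_def u_def)
    then have "axis i x1 + axis j x2 + axis l x3 - axis k c = 0" by (rule inj)
    then have "(axis i x1 + axis j x2 + axis l x3 - axis k c) $ n = 0" for n by simp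
    from this[of i] this[of j] this[of l] show False
      using x(1) ijl ijlk by (simp add: axis_def)
  qed
  then obtain z' where "polar F w z' \<noteq> 0" using rad[OF Fw] by blast
  \<comment> \<open>Since \<open>F w = 0\<close>, adding \<open>t *s w\<close> changes
    \<open>F z'\<close> by exactly \<open>t * polar F w z'\<close>, without changing the pairing
    with \<open>w\<close>.\<close>
  moreover define t where "t = - F z' / polar F w z'"
  ultimately have t: "t * polar F w z' = - F z'" by simp
  define z0 where "z0 = z' + t *s w"
  have Fz0: "F z0 = 0" and \<beta>0: "polar F w z0 \<noteq> 0"
    using Fw t \<open>polar F w z' \<noteq> 0\<close> by (auto simp: z0_def expand polar_self polar_commute[of z' w])
  define \<beta> where "\<beta> = polar F w z0"
  have \<beta>: "\<beta> \<noteq> 0" using \<beta>0 by (simp add: \<beta>_def)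
  \<comment> \<open>At most q^3 of the q^4 vectors are combinations of \<open>w\<close>,
    \<open>z0\<close> and \<open>u\<close>, so some vector lies outside their span.\<close>
  have "card (range (\<lambda>(a, b, d). a *s w + b *s z0 + d *s u)) \<le> CARD('a \<times> 'a \<times> 'a)"
    by (rule card_image_le) simp
  also have "\<dots> < CARD('a ^ 4)"
  proof -
    have "1 < CARD('a)" using card_mono[of UNIV "{0, 1 :: 'a}"] by simp
    then show ?thesis by (simp add: power4_eq_xxxx)
  qed
  finally have "range (\<lambda>(a, b, d). a *s w + b *s z0 + d *s u) \<noteq> UNIV" by auto
  then obtain y0 where "y0 \<notin> range (\<lambda>(a, b, d). a *s w + b *s z0 + d *s u)" by blast
  then have y0: "y0 \<noteq> a *s w + b *s z0 + d *s u" for a b d by (auto simp: image_iff)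
  \<comment> \<open>The component of \<open>y0\<close> in the hyperbolic plane is removed. Each
    coefficient involves the pairing with the opposite vector, since \<open>w\<close> and
    \<open>z0\<close> are singular.\<close>
  define y where "y = y0 + (- polar F y0 z0 / \<beta>) *s w + (- polar F y0 w / \<beta>) *s z0"
  have y_notin: "c *s y \<noteq> d *s u" if "c \<noteq> 0" for c d
  proof
    assume "c *s y = d *s u"
    then have "inverse c *s (c *s y) = inverse c *s (d *s u)" by simp
    then have "y = (d / c) *s u" using that by (simp add: vector_smult_assoc field_simps)
    then have "y0 = (polar F y0 z0 / \<beta>) *s w + (polar F y0 w / \<beta>) *s z0 + (d / c) *s u"
      by (simp add: y_def vec_eq_iff algebra_simps)
    then show False using y0 by blast
  qed
  have zw: "polar F z0 w = \<beta>" "polar F w z0 = \<beta>" by (simp_all add: \<beta>_def polar_commute)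
  have wwzz: "polar F w w = 0" "polar F z0 z0 = 0" by (simp_all add: polar_self Fw Fz0)
  have yl: "polar F y w = 0" "polar F y z0 = 0"
    unfolding y_def expand zw wwzz using \<beta> by simp_all
  then have y: "polar F y w = 0" "polar F y z0 = 0" "polar F w y = 0" "polar F z0 y = 0"
    by (simp_all add: polar_commute[of _ y])
  let ?comb = "\<lambda>(a, b, c, d). a *s w + b *s z0 + c *s y + d *s u"
  have indep: "a = 0 \<and> b = 0 \<and> c = 0 \<and> d = 0" if "a *s w + b *s z0 + c *s y + d *s u = 0" for a b c d
  proof -
    have "polar F (a *s w + b *s z0 + c *s y + d *s u) v = 0" for v
      unfolding that using polar_scale[of 0 0 v] by simp
    \<comment> \<open>Pairing with \<open>z0\<close> leaves only a \<beta>, and pairing with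
      \<open>w\<close> leaves only b \<beta>.\<close>
    from this[of z0] this[of w] have ab: "a = 0" "b = 0" using \<beta> by (simp_all add: expand zw wwzz y u)
    then have "c *s y = (- d) *s u" using that by (simp add: vec_eq_iff eq_neg_iff_add_eq_0)
    then have c: "c = 0" using y_notin by metis
    have "u \<noteq> 0" using inj[of "axis k 1"] by (auto simp: u_def A_axis)
    then show ?thesis using that ab c by simp
  qed
  have coords: "a = a' \<and> b = b' \<and> c = c' \<and> d = d'"
    if "a *s w + b *s z0 + c *s y + d *s u = a' *s w + b' *s z0 + c' *s y + d' *s u" for a b c d a' b' c' d'
  proof -
    have "(a - a') *s w + (b - b') *s z0 + (c - c') *s y + (d - d') *s u = 0"
      using that by (simp add: vec_eq_iff algebra_simps)
    from indep[OF this] show ?thesis by simp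
  qed
  have "inj ?comb"
  proof (rule injI)
    fix p p' assume eq: "?comb p = ?comb p'"
    obtain a b c d where p: "p = (a, b, c, d)" by (rule prod_cases4)
    obtain a' b' c' d' where p': "p' = (a', b', c', d')" by (rule prod_cases4)
    show "p = p'" using coords[of a b c d a' b' c' d'] eq unfolding p p' by simp
  qed
  moreover have "card (range ?comb) = card (UNIV :: ('a ^ 4) set)"
    unfolding card_image[OF \<open>inj ?comb\<close>] by (simp add: power4_eq_xxxx)
  then have "surj ?comb" using card_subset_eq[OF finite subset_UNIV] by blast
  ultimately have bij: "bij ?comb" by (simp add: bij_def)
  have F0: "F (a *s w + b *s z0 + c *s y + d *s u) = a * b * \<beta> + c\<^sup>2 * F y" for a b c d
    by (simp add: expand Fw Fz0 u u' y zw)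
  \<comment> \<open>If \<open>F y\<close> were 0, then \<open>y\<close> would be singular and
    orthogonal to the whole basis, hence a multiple of \<open>u\<close>.\<close>
  have Fy: "F y \<noteq> 0"
  proof
    assume Fy0: "F y = 0"
    have "polar F y v = 0" for v
    proof -
      obtain a b c d where "v = a *s w + b *s z0 + c *s y + d *s u"
        using surjD[OF \<open>surj ?comb\<close>, of v] by (auto split: prod.splits)
      then show ?thesis by (simp add: expand y u' polar_self Fy0)
    qed
    then obtain d where "y = d *s u" using rad Fy0 by blast
    then show False using y_notin[of 1 d] by simp
  qed
  \<comment> \<open>The rescaling turns the hyperbolic term \<beta> a b into -e a b, so that
    \<open>e\<close> becomes a common factor.\<close>
  define e z where "e = F y" and "z = (- e / \<beta>) *s z0"
  have e: "e \<noteq> 0" by (simp add: e_def Fy)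
  have resc: "a *s w + b *s z + c *s y + d *s u = a *s w + (- b * e / \<beta>) *s z0 + c *s y + d *s u" for a b c d
    by (simp add: z_def vector_smult_assoc)
  let ?resc = "\<lambda>(a, b, c, d). (a, - b * e / \<beta>, c, d)"
  have comb_resc: "(\<lambda>(a, b, c, d). a *s w + b *s z + c *s y + d *s u) = ?comb \<circ> ?resc"
    unfolding resc by (rule ext) (simp only: comp_def split: prod.split, simp)
  have "bij ?resc"
    by (rule bij_betw_byWitness[of _ "\<lambda>(a, b, c, d). (a, - b * \<beta> / e, c, d)"]) (use e \<beta> in auto)
  then have bij': "bij (\<lambda>(a, b, c, d). a *s w + b *s z + c *s y + d *s u)"
    unfolding comb_resc by (rule bij_comp[OF _ bij])
  have normal: "F (a *s w + b *s z + c *s y + d *s u) = e * (c\<^sup>2 - a * b)" for a b c d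
    unfolding resc F0 using \<beta> by (simp add: e_def algebra_simps)
  show ?thesis by (rule that[OF e bij' normal])
qed

subsection \<open>Points on the cone\<close>

lemma PG3_iff: "P \<in> PG3 \<longleftrightarrow> (\<exists>p. p \<noteq> 0 \<and> P = range (\<lambda>k. k *s p))"
proof
  assume P: "P \<in> PG3"
  obtain B where B: "B \<subseteq> P" "vec.independent B" "P \<subseteq> vec.span B" "card B = vec.dim P"
    by (rule vec.basis_exists)
  then obtain p where p: "B = {p}" using P by (auto simp: PG3_def card_1_singleton_iff)
  have "vec.span B = P" using B P vec.span_minimal[OF B(1)] by (auto simp: PG3_def)
  moreover have "p \<noteq> 0" using B(2) p vec.dependent_zero by blast
  ultimately show "\<exists>p. p \<noteq> 0 \<and> P = range (\<lambda>k. k *s p)"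
    using p vec.span_singleton by blast
next
  assume "\<exists>p. p \<noteq> 0 \<and> P = range (\<lambda>k. k *s p)"
  then obtain p where p: "p \<noteq> 0" "P = vec.span {p}" unfolding vec.span_singleton by blast
  then have "vec.dim P = card {p}"
    by (intro vec.dim_eq_card) (auto simp: vec.span_span)
  then show "P \<in> PG3" using p by (simp add: PG3_def)
qed

text \<open>Normalised coordinates listing each point of c^2 = a b once: \<open>None\<close> is the
  vertex, and \<open>Some (s, d)\<close> is a further point on generator \<open>s\<close>.
  Generators are indexed by the projective line \<open>'a option\<close>, with \<open>None\<close>
  as infinity.\<close>

definition cone_coord :: "('a::field option \<times> 'a) option \<Rightarrow> 'a \<times> 'a \<times> 'a \<times> 'a" where
  "cone_coord x = (case x of None \<Rightarrow> (0, 0, 0, 1)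
    | Some (None, d) \<Rightarrow> (0, 1, 0, d) | Some (Some t, d) \<Rightarrow> (1, t\<^sup>2, t, d))"

text \<open>One divides by the first nonzero among a, b and d; when a = 0 the equation forces c =
  0.\<close>

lemma cone_coord_exists:
  assumes "c\<^sup>2 = a * b" "(a, b, c, d) \<noteq> (0, 0, 0, 0 :: 'a::field)"
  obtains x k a' b' c' d' where "k \<noteq> 0" "cone_coord x = (a', b', c', d')"
    "a = k * a'" "b = k * b'" "c = k * c'" "d = k * d'"
proof (cases "a = 0")
  case False
  then show ?thesis
    using that[of a "Some (Some (c / a), d / a)" 1 "(c / a)\<^sup>2" "c / a" "d / a"] assms(1)
    by (simp add: cone_coord_def power_divide power2_eq_square)
next
  case True
  then have c: "c = 0" using assms(1) by simp
  show ?thesis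
  proof (cases "b = 0")
    case False
    then show ?thesis using that[of b "Some (None, d / b)" 0 1 0 "d / b"] True c
      by (simp add: cone_coord_def)
  next
    case b: True
    then show ?thesis using that[of d None 0 0 0 1] True c assms(2) by (simp add: cone_coord_def)
  qed
qed

lemma cone_coord_unique:
  assumes "cone_coord x = (a, b, c, d)" "cone_coord x' = (a', b', c', d')"
    "a = k * a'" "b = k * b'" "c = k * c'" "d = k * (d' :: 'a::field)"
  shows "x = x'"
  using assms by (auto simp: cone_coord_def split: option.splits prod.splits)

lemma cone_coord_on_cone:
  assumes "cone_coord x = (a, b, c, d)"
  shows "c\<^sup>2 = a * b" "(a, b, c, d) \<noteq> (0, 0, 0, 0)"
  using assms by (auto simp: cone_coord_def split: option.splits prod.splits)

text \<open>\<open>p\<close> is a dehomogenised binary form of degree n, and \<open>None\<close> is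
  the point at infinity. If that point is a zero, the degree of \<open>p\<close> drops below n,
  which pays for the extra zero.\<close>

lemma card_zeros_binary_form:
  fixes p :: "'a::field poly"
  assumes "p \<noteq> 0" "degree p \<le> n"
  shows "card {s. case s of None \<Rightarrow> coeff p n = 0 | Some t \<Rightarrow> poly p t = 0} \<le> n"
proof -
  let ?R = "{t. poly p t = 0}"
  let ?Z = "{s. case s of None \<Rightarrow> coeff p n = 0 | Some t \<Rightarrow> poly p t = 0}"
  have fin: "finite ?R" using assms(1) by (rule poly_roots_finite)
  have R: "card (Some ` ?R) \<le> degree p"
    using card_poly_roots_bound[OF assms(1)] by (simp add: card_image)
  show ?thesis
  proof (cases "coeff p n = 0")
    case True
    then have "degree p < n" using assms by (metis leading_coeff_0_iff le_neq_implies_less)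
    moreover have "?Z = insert None (Some ` ?R)"
    proof (rule set_eqI)
      show "s \<in> ?Z \<longleftrightarrow> s \<in> insert None (Some ` ?R)" for s using True by (cases s) auto
    qed
    moreover have "card (insert None (Some ` ?R)) \<le> Suc (card (Some ` ?R))"
      by (rule card_insert_le_m1) auto
    ultimately show ?thesis using R by simp
  next
    case False
    have "?Z = Some ` ?R"
    proof (rule set_eqI)
      show "s \<in> ?Z \<longleftrightarrow> s \<in> Some ` ?R" for s using False by (cases s) auto
    qed
    then show ?thesis using R assms(2) by simp
  qed
qed

lemma card_quadratic_zeros_le:
  fixes \<alpha> \<beta> \<gamma> :: "'a::field"
  assumes "\<gamma> \<noteq> 0"
  shows "card {d. \<alpha> + d * \<beta> + d\<^sup>2 * \<gamma> = 0} \<le> 2"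
proof -
  have "card {d. poly [:\<alpha>, \<beta>, \<gamma>:] d = 0} \<le> degree [:\<alpha>, \<beta>, \<gamma>:]"
    using assms by (intro card_poly_roots_bound) simp
  then show ?thesis using assms by (simp add: power2_eq_square algebra_simps)
qed

lemma card_linear_zeros:
  fixes \<alpha> \<beta> :: "'a::field"
  shows "card {d. \<alpha> + d * \<beta> = 0} = (if \<beta> \<noteq> 0 then 1 else if \<alpha> = 0 then CARD('a) else 0)"
proof (cases "\<beta> = 0")
  case False
  then have "{d. \<alpha> + d * \<beta> = 0} = {- \<alpha> / \<beta>}"
    by (auto simp: field_simps eq_neg_iff_add_eq_0 add.commute)
  then show ?thesis using False by simp
qed auto

text \<open>The conic c^2 = a b cut from the cone by the plane d = 0, parametrised by (1, t^2, t)
  and by (0, 1, 0) at infinity.\<close>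

definition conic_point :: "'a::field ^ 'n \<Rightarrow> 'a ^ 'n \<Rightarrow> 'a ^ 'n \<Rightarrow> 'a option \<Rightarrow> 'a ^ 'n" where
  "conic_point w z y s = (case s of None \<Rightarrow> z | Some t \<Rightarrow> w + t\<^sup>2 *s z + t *s y)"

text \<open>The normalised coordinates give a bijection onto the points of the cone. The vertex is
  counted separately, since it lies on every generator.\<close>

lemma card_cone_inter:
  fixes F G :: "'a::{field,finite} ^ 4 \<Rightarrow> 'a"
  assumes F: "quadratic_map F" and G: "quadratic_map G" and e: "e \<noteq> 0"
    and bij: "bij (\<lambda>(a, b, c, d). a *s w + b *s z + c *s y + d *s u)"
    and normal: "\<And>a b c d. F (a *s w + b *s z + c *s y + d *s u) = e * (c\<^sup>2 - a * b)"
  shows "card {P \<in> PG3. (\<forall>v\<in>P. F v = 0) \<and> (\<forall>v\<in>P. G v = 0)} =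
    (if G u = 0 then 1 else 0) + (\<Sum>s\<in>UNIV. card {d. G (conic_point w z y s + d *s u) = 0})"
proof -
  let ?comb = "\<lambda>(a, b, c, d). a *s w + b *s z + c *s y + d *s u"
  let ?pt = "\<lambda>x. ?comb (cone_coord x)"
  let ?S = "{x. G (?pt x) = 0}"
  let ?line = "\<lambda>p :: 'a ^ 4. range (\<lambda>k. k *s p)"
  let ?I = "{P \<in> PG3. (\<forall>v\<in>P. F v = 0) \<and> (\<forall>v\<in>P. G v = 0)}"
  have inj: "?comb p = ?comb p' \<Longrightarrow> p = p'" for p p' using bij by (meson bij_is_inj injD)
  have scale: "k *s ?comb (a, b, c, d) = ?comb (k * a, k * b, k * c, k * d)" for k a b c d
    by (simp add: vector_add_ldistrib vector_smult_assoc)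
  have zero: "?comb (0, 0, 0, 0) = 0" by simp
  have "bij_betw (\<lambda>x. ?line (?pt x)) ?S ?I"
  proof (rule bij_betw_imageI)
    show "inj_on (\<lambda>x. ?line (?pt x)) ?S"
    proof (rule inj_onI)
      fix x x' assume eq: "?line (?pt x) = ?line (?pt x')"
      obtain a b c d where x: "cone_coord x = (a, b, c, d)" by (rule prod_cases4)
      obtain a' b' c' d' where x': "cone_coord x' = (a', b', c', d')" by (rule prod_cases4)
      have "1 *s ?pt x \<in> ?line (?pt x)" by (rule rangeI)
      then obtain k where "?pt x = k *s ?pt x'" unfolding eq by auto
      then have "(a, b, c, d) = (k * a', k * b', k * c', k * d')"
        unfolding x x' scale by (rule inj)
      then show "x = x'" using cone_coord_unique[OF x x', of k] by auto
    qed
    show "(\<lambda>x. ?line (?pt x)) ` ?S = ?I"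
    proof (intro subset_antisym subsetI)
      fix P assume "P \<in> (\<lambda>x. ?line (?pt x)) ` ?S"
      then obtain x where x: "G (?pt x) = 0" "P = ?line (?pt x)" by blast
      obtain a b c d where c: "cone_coord x = (a, b, c, d)" by (rule prod_cases4)
      have "?pt x \<noteq> 0"
        using inj[of "(a, b, c, d)" "(0, 0, 0, 0)"] cone_coord_on_cone(2)[OF c] unfolding c zero by blast
      then have "P \<in> PG3" unfolding PG3_iff using x(2) by blast
      moreover have "F (?pt x) = 0" unfolding c using normal cone_coord_on_cone(1)[OF c] by simp
      ultimately show "P \<in> ?I"
        using x by (auto simp: quadratic_map.scale[OF F] quadratic_map.scale[OF G])
    next
      fix P assume P: "P \<in> ?I"
      then obtain p where p: "p \<noteq> 0" "P = ?line p" by (auto simp: PG3_iff)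
      have "1 *s p \<in> P" unfolding p(2) by (rule rangeI)
      then have FG: "F p = 0" "G p = 0" using P by auto
      have "p \<in> range ?comb" using bij_is_surj[OF bij] by simp
      then obtain q where q: "p = ?comb q" by blast
      obtain a b c d where abcd: "q = (a, b, c, d)" by (rule prod_cases4)
      have comb: "p = ?comb (a, b, c, d)" unfolding q abcd by simp
      have on: "c\<^sup>2 = a * b" using FG(1) e normal[of a b c d] unfolding comb by simp
      have ne: "(a, b, c, d) \<noteq> (0, 0, 0, 0)" using p(1) zero unfolding comb by blast
      obtain x k a' b' c' d' where k: "k \<noteq> 0" and x: "cone_coord x = (a', b', c', d')"
        and eq: "a = k * a'" "b = k * b'" "c = k * c'" "d = k * d'"
        using cone_coord_exists[OF on ne] by metis
      have pk: "p = k *s ?pt x" unfolding comb x eq scale ..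
      then have "G (?pt x) = 0" using FG(2) k by (simp add: quadratic_map.scale[OF G])
      moreover have "?line p = ?line (?pt x)"
      proof (intro subset_antisym subsetI)
        fix v assume "v \<in> ?line p"
        then obtain l where "v = (l * k) *s ?pt x" unfolding pk vector_smult_assoc by blast
        then show "v \<in> ?line (?pt x)" by blast
      next
        fix v assume "v \<in> ?line (?pt x)"
        then obtain l where "v = l *s ?pt x" by blast
        then have "v = (l / k) *s p" unfolding pk vector_smult_assoc using k by simp
        then show "v \<in> ?line p" by blast
      qed
      ultimately show "P \<in> (\<lambda>x. ?line (?pt x)) ` ?S" using p(2) by blast
    qed
  qed
  then have "card ?I = card ?S" by (simp add: bij_betw_same_card)
  also have "\<dots> = card ((if G u = 0 then {None} else {}) \<union>
      Some ` (SIGMA s:UNIV. {d. G (conic_point w z y s + d *s u) = 0}))"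
  proof -
    have "?pt None = u" by (simp add: cone_coord_def)
    moreover have "?pt (Some (s, d)) = conic_point w z y s + d *s u" for s d
      by (cases s) (simp_all add: cone_coord_def conic_point_def)
    ultimately have "x \<in> ?S \<longleftrightarrow> x \<in> (if G u = 0 then {None} else {}) \<union>
      Some ` (SIGMA s:UNIV. {d. G (conic_point w z y s + d *s u) = 0})" for x
      by (cases x) auto
    then show ?thesis by (metis set_eqI)
  qed
  also have "\<dots> = card (if G u = 0 then {None} else {} :: ('a option \<times> 'a) option set) +
      card (Some ` (SIGMA s:UNIV. {d. G (conic_point w z y s + d *s u) = 0}))"
    by (rule card_Un_disjoint) auto
  also have "\<dots> = (if G u = 0 then 1 else 0) + (\<Sum>s\<in>UNIV. card {d. G (conic_point w z y s + d *s u) = 0})"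
    by (simp add: card_image)
  finally show ?thesis .
qed

section \<open>Intersection with a second quadric\<close>

theorem proposition5p1:
  fixes X Q' :: "('a::{field,finite} ^ 4) set set"
    and q :: nat
  assumes "CARD('a) = q" and "q \<ge> 3"
    and "quadric Q'"
    and "quadric_cone X"
    and "Q' \<noteq> X"
  shows "card (X \<inter> Q') = 4 * q + 1 \<or> card (X \<inter> Q') = 3 * q + 1 \<or> card (X \<inter> Q') \<le> 3 * q"
proof -
  obtain f where f: "homogeneous 2 f" "form_rank f = 3" and X: "X = zero_locus f"
    using assms(4) by (auto simp: quadric_cone_def quadratic_form_def homogeneous_def)
  obtain g where g: "homogeneous 2 g" "g \<noteq> 0" and Q': "Q' = zero_locus g"
    using assms(3) by (auto simp: quadric_def quadratic_form_def homogeneous_def)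
  define F G where "F = eval4 f" and "G = eval4 g"
  have F: "quadratic_map F" unfolding F_def using f(1) by (rule quadratic_map_eval4)
  interpret G: quadratic_map G unfolding G_def using g(1) by (rule quadratic_map_eval4)
  obtain A :: "'a ^ 4 ^ 4" and k where A: "invertible A"
    and rad: "F (column k A) = 0" "\<And>v. polar F (column k A) v = 0"
      "\<And>r. F r = 0 \<Longrightarrow> (\<And>v. polar F r v = 0) \<Longrightarrow> \<exists>c. r = c *s column k A"
    unfolding F_def using form_rank_3_radical[OF f] by metis
  define u where "u = column k A"
  obtain e w z y where e: "e \<noteq> 0"
    and bij: "bij (\<lambda>(a, b, c, d). a *s w + b *s z + c *s y + d *s u)"
    and normal: "\<And>a b c d. F (a *s w + b *s z + c *s y + d *s u) = e * (c\<^sup>2 - a * b)"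
  proof (rule cone_normal_form[OF F A u_def])
    show "F u = 0" "\<And>v. polar F u v = 0" using rad(1,2) by (simp_all add: u_def)
    show "\<exists>c. r = c *s u" if "F r = 0" "\<And>v. polar F r v = 0" for r
      using rad(3)[OF that] by (simp add: u_def)
  qed (rule that)
  define p where "p = conic_point w z y"
  define m where "m s = card {d. G (p s + d *s u) = 0}" for s
  have "X \<inter> Q' = {P \<in> PG3. (\<forall>v\<in>P. F v = 0) \<and> (\<forall>v\<in>P. G v = 0)}"
    by (auto simp: X Q' zero_locus_def F_def G_def)
  then have N: "card (X \<inter> Q') = (if G u = 0 then 1 else 0) + (\<Sum>s\<in>UNIV. m s)"
    using card_cone_inter[OF F G.quadratic_map_axioms e bij normal] by (simp add: m_def p_def)
  have m: "m s = card {d. G (p s) + d * polar G (p s) u + d\<^sup>2 * G u = 0}" for s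
    by (simp add: m_def G.expand algebra_simps)
  consider "G u \<noteq> 0" | "G u = 0" "\<exists>v. polar G v u \<noteq> 0" | "G u = 0" "\<And>v. polar G v u = 0" by blast
  then show ?thesis
  proof cases
    case 1
    have "(\<Sum>s\<in>UNIV. m s) \<le> (\<Sum>s\<in>(UNIV :: 'a option set). 2)"
      unfolding m using 1 by (intro sum_mono card_quadratic_zeros_le)
    \<comment> \<open>There are q + 1 generators; the vertex is not a common point, and 2 (q + 1) is
      at most 3 q.\<close>
    also have "\<dots> = 2 * (q + 1)" by (simp add: card_UNIV_option assms(1))
    finally show ?thesis using 1 N assms(2) by simp
  next
    case 2
    let ?Z = "{s. polar G (p s) u = 0}"
    \<comment> \<open>This is \<open>polar G (p (Some t)) u\<close> as a polynomial in t. If it were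
      zero, \<open>polar G _ u\<close> would vanish at \<open>w\<close>, \<open>y\<close>,
      \<open>z\<close>, and also at \<open>u\<close>, where it equals
      \<open>2 * G u = 0\<close>.\<close>
    let ?r = "[:polar G w u, polar G y u, polar G z u:]"
    have "?r \<noteq> 0"
    proof
      assume r: "?r = 0"
      obtain v where v: "polar G v u \<noteq> 0" using 2 by blast
      obtain t where "v = (case t of (a, b, c, d) \<Rightarrow> a *s w + b *s z + c *s y + d *s u)"
        using surjD[OF bij_is_surj[OF bij]] by blast
      then obtain a b c d where "v = a *s w + b *s z + c *s y + d *s u" by (cases t) auto
      then show False using v r 2(1) by (simp add: G.expand G.polar_self)
    qed
    then have "card {s. case s of None \<Rightarrow> coeff ?r 2 = 0 | Some t \<Rightarrow> poly ?r t = 0} \<le> 2"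
      by (rule card_zeros_binary_form) simp
    moreover have "{s. case s of None \<Rightarrow> coeff ?r 2 = 0 | Some t \<Rightarrow> poly ?r t = 0} = ?Z"
    proof (rule set_eqI)
      show "s \<in> {s. case s of None \<Rightarrow> coeff ?r 2 = 0 | Some t \<Rightarrow> poly ?r t = 0} \<longleftrightarrow> s \<in> ?Z" for s
        by (cases s) (simp_all add: p_def conic_point_def G.expand numeral_2_eq_2 algebra_simps)
    qed
    ultimately have Z: "card ?Z \<le> 2" by simp
    have "m s \<le> 1 + (if s \<in> ?Z then q - 1 else 0)" for s
      using card_linear_zeros[of "G (p s)" "polar G (p s) u"] assms(1,2) 2(1) by (simp add: m)
    then have "(\<Sum>s\<in>UNIV. m s) \<le> (\<Sum>s\<in>UNIV. 1 + (if s \<in> ?Z then q - 1 else 0))"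
      by (intro sum_mono)
    also have "\<dots> = q + 1 + card ?Z * (q - 1)"
      unfolding sum.distrib by (simp add: sum.If_cases card_UNIV_option assms(1))
    \<comment> \<open>With the vertex added, the bound is 1 + (q + 1) + 2 (q - 1) = 3 q.\<close>
    also have "\<dots> \<le> q + 1 + 2 * (q - 1)" using Z by (intro add_mono mult_mono) auto
    finally have "card (X \<inter> Q') \<le> 3 * q" using N 2(1) assms(2) by simp
    then show ?thesis by simp
  next
    case 3
    let ?Z = "{s. G (p s) = 0}"
    \<comment> \<open>This is \<open>G (p (Some t))\<close> as a polynomial in t. The middle
      coefficient has two sources: t^2 arises from \<open>w\<close> with \<open>z\<close> and from
      the square of \<open>y\<close>.\<close>
    let ?r = "[:G w, polar G w y, polar G w z + G y, polar G z y, G z:]"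
    have u: "polar G v u = 0" for v using 3 by blast
    have expand: "G (a *s w + b *s z + c *s y + d *s u) = a\<^sup>2 * G w + b\<^sup>2 * G z + c\<^sup>2 * G y
        + a * b * polar G w z + a * c * polar G w y + b * c * polar G z y" for a b c d
      using 3(1) u by (simp add: G.expand algebra_simps)
    have "?r \<noteq> 0"
    proof
      assume "?r = 0"
      then have r: "G w = 0" "polar G w y = 0" "polar G w z = - G y" "polar G z y = 0" "G z = 0"
        by (simp_all add: eq_neg_iff_add_eq_0)
      \<comment> \<open>When all coefficients vanish, \<open>G\<close> reduces to \<open>G y\<close>
        times c^2 - a b, hence is proportional to \<open>F\<close>. A zero factor contradicts
        \<open>g \<noteq> 0\<close>; a nonzero one makes the two quadrics equal.\<close>
      have GF: "e * G v = G y * F v" for v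
      proof -
        obtain t where "v = (case t of (a, b, c, d) \<Rightarrow> a *s w + b *s z + c *s y + d *s u)"
          using surjD[OF bij_is_surj[OF bij]] by blast
        then obtain a b c d where v: "v = a *s w + b *s z + c *s y + d *s u" by (cases t) auto
        show ?thesis unfolding v expand normal r by (simp add: algebra_simps)
      qed
      show False
      proof (cases "G y = 0")
        case True
        then have "G v = 0" for v using GF[of v] e by simp
        then show False using homogeneous_2_eval4_eq_0[OF g(1)] g(2) by (simp add: G_def)
      next
        case False
        then have "G v = 0 \<longleftrightarrow> F v = 0" for v using GF[of v] e by (metis mult_eq_0_iff)
        then have "Q' = X" by (simp add: X Q' zero_locus_def F_def G_def)
        then show False using assms(5) by simp
      qed
    qed
    then have "card {s. case s of None \<Rightarrow> coeff ?r 4 = 0 | Some t \<Rightarrow> poly ?r t = 0} \<le> 4"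
      by (rule card_zeros_binary_form) simp
    moreover have "{s. case s of None \<Rightarrow> coeff ?r 4 = 0 | Some t \<Rightarrow> poly ?r t = 0} = ?Z"
    proof (rule set_eqI)
      have "p (Some t) = 1 *s w + t\<^sup>2 *s z + t *s y + 0 *s u" for t
        by (simp add: p_def conic_point_def)
      then have "G (p (Some t)) = poly ?r t" for t
        by (simp only: expand) (simp add: algebra_simps power2_eq_square)
      moreover have "p None = z" by (simp add: p_def conic_point_def)
      ultimately show "s \<in> {s. case s of None \<Rightarrow> coeff ?r 4 = 0 | Some t \<Rightarrow> poly ?r t = 0} \<longleftrightarrow> s \<in> ?Z" for s
        by (cases s) (simp_all add: eval_nat_numeral)
    qed
    ultimately have Z: "card ?Z \<le> 4" by simp
    \<comment> \<open>With \<open>u\<close> in the radical of \<open>G\<close>, the value is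
      constant along a generator away from the vertex: either all q such points are common or none
      is.\<close>
    have "m s = (if s \<in> ?Z then q else 0)" for s
      using card_linear_zeros[of "G (p s)" 0] 3(1) by (simp add: m u assms(1))
    then have "(\<Sum>s\<in>UNIV. m s) = card ?Z * q"
      by (simp add: sum.If_cases del: mem_Collect_eq)
    then have card: "card (X \<inter> Q') = 1 + card ?Z * q" using N 3(1) by simp
    consider "card ?Z = 4" | "card ?Z = 3" | "card ?Z \<le> 2" using Z by linarith
    then show ?thesis
    proof cases
      case 3
      \<comment> \<open>At most two common generators give at most 2 q + 1 points, which is within 3
        q.\<close>
      then have "card ?Z * q \<le> 2 * q" by (rule mult_le_mono1)
      then show ?thesis using card assms(2) by linarith
    qed (use card in simp_all)
  qed
qed

end
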